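(* Let $G=(S,T;E)$ be a bipartite graph with $|S|=n$, $w:E\to\mathbb R_+$, $d\in\mathbb N$ and $b:S\cup T\to\mathbb Z_+\cup\{\infty\}$. Consider the following randomized algorithm (Algorithm 2): define $b'(v)=b(v)$ for $v\in S$ and $b'(t)=\min\{\lceil n/d\rceil,b(t)\}$ for $t\in T$; find a maximum-weight $b'$-matching $\widehat M$ of $G$ (an edge set in which every $v$ has degree at most $b'(v)$); generate a permutation $s_1,\dots,s_n$ of $S$ uniformly at random; let $M$ consist of all edges $s_it\in\widehat M$ such that none of $s_{\max\{1,i-d+1\}}t,\dots,s_{i-1}t$ belongs to $\widehat M$; output $s_1,\dots,s_n$ and $M$. Then $M$ is a feasible $d$-distance $b$-matching under the ordering $s_1,\dots,s_n$, and its expected weight is at least \[ \max\left\{\left(1-\frac1d\right)^{d-1},\ \frac{1+(k-1)\left(1-\frac{1}{k-1}\right)^k}{k}\right\} \] times the maximum, over all orderings of $S$, of the weight of a heaviest $d$-distance $b$-matching under that ordering, where $k=\max_{t\in T}b'(t)$. This lower bound is tight.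
   Context: For an ordering $s_1,\dots,s_n$ of $S$, an edge set $M\subseteq E$ is a $d$-distance $b$-matching if every $v\in S\cup T$ has degree at most $b(v)$ in $M$ and whenever $s_it,s_jt\in M$ with $i\ne j$, $|i-j|\ge d$. The weight of $M$ is $w(M)=\sum_{e\in M}w(e)$. *)

theory Defs
  imports
    "HOL-Probability.Probability"
    "HOL-Combinatorics.Multiset_Permutations"
    "HOL-Library.Extended_Nat"
begin

text \<open>
  The edge between \<open>s \<in> S\<close> and \<open>t \<in> T\<close> is represented by the pair \<open>(s, t)\<close>.
  Orderings of \<open>S\<close> are the lists in \<^term>\<open>permutations_of_set S\<close>; since list
  positions start at 0, \<open>xs ! i\<close> is the node usually written with index \<open>i + 1\<close>.
\<close>

definition bip_instance ::
    "'v set \<Rightarrow> 'v set \<Rightarrow> ('v \<times> 'v) set \<Rightarrow> ('v \<times> 'v \<Rightarrow> real) \<Rightarrow> nat \<Rightarrow> bool" where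
  "bip_instance S T E w d \<longleftrightarrow>
     finite S \<and> finite T \<and> S \<inter> T = {} \<and> E \<subseteq> S \<times> T \<and> (\<forall>e\<in>E. 0 \<le> w e) \<and> 1 \<le> d"

definition edge_degree :: "('v \<times> 'v) set \<Rightarrow> 'v \<Rightarrow> nat" where
  "edge_degree M v = card {e \<in> M. fst e = v \<or> snd e = v}"

definition weight :: "('v \<times> 'v \<Rightarrow> real) \<Rightarrow> ('v \<times> 'v) set \<Rightarrow> real" where
  "weight w M = (\<Sum>e\<in>M. w e)"

definition b_matching ::
    "'v set \<Rightarrow> 'v set \<Rightarrow> ('v \<times> 'v) set \<Rightarrow> ('v \<Rightarrow> enat) \<Rightarrow> ('v \<times> 'v) set \<Rightarrow> bool" where
  "b_matching S T E b M \<longleftrightarrow> M \<subseteq> E \<and> (\<forall>v\<in>S \<union> T. enat (edge_degree M v) \<le> b v)"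

definition max_weight_b_matching ::
    "'v set \<Rightarrow> 'v set \<Rightarrow> ('v \<times> 'v) set \<Rightarrow> ('v \<times> 'v \<Rightarrow> real) \<Rightarrow> ('v \<Rightarrow> enat) \<Rightarrow> ('v \<times> 'v) set \<Rightarrow> bool" where
  "max_weight_b_matching S T E w b M \<longleftrightarrow>
     b_matching S T E b M \<and> (\<forall>M'. b_matching S T E b M' \<longrightarrow> weight w M' \<le> weight w M)"

definition distance_b_matching ::
    "'v set \<Rightarrow> 'v set \<Rightarrow> ('v \<times> 'v) set \<Rightarrow> nat \<Rightarrow> ('v \<Rightarrow> enat) \<Rightarrow> 'v list \<Rightarrow> ('v \<times> 'v) set \<Rightarrow> bool" where
  "distance_b_matching S T E d b xs M \<longleftrightarrow>
     b_matching S T E b M \<and>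
     (\<forall>i<length xs. \<forall>j<length xs. \<forall>t.
        (xs ! i, t) \<in> M \<and> (xs ! j, t) \<in> M \<and> i \<noteq> j \<longrightarrow> int d \<le> \<bar>int i - int j\<bar>)"

definition heaviest_weight ::
    "'v set \<Rightarrow> 'v set \<Rightarrow> ('v \<times> 'v) set \<Rightarrow> ('v \<times> 'v \<Rightarrow> real) \<Rightarrow> nat \<Rightarrow> ('v \<Rightarrow> enat) \<Rightarrow> 'v list \<Rightarrow> real" where
  "heaviest_weight S T E w d b xs = Max (weight w ` {M. distance_b_matching S T E d b xs M})"

definition optimum ::
    "'v set \<Rightarrow> 'v set \<Rightarrow> ('v \<times> 'v) set \<Rightarrow> ('v \<times> 'v \<Rightarrow> real) \<Rightarrow> nat \<Rightarrow> ('v \<Rightarrow> enat) \<Rightarrow> real" where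
  "optimum S T E w d b = Max (heaviest_weight S T E w d b ` permutations_of_set S)"

definition reduced_bound :: "'v set \<Rightarrow> 'v set \<Rightarrow> nat \<Rightarrow> ('v \<Rightarrow> enat) \<Rightarrow> 'v \<Rightarrow> enat" where
  "reduced_bound S T d b v =
     (if v \<in> T then min (enat (nat \<lceil>real (card S) / real d\<rceil>)) (b v) else b v)"

text \<open>
  On \<open>T\<close> the reduced bounds are finite, so \<open>the_enat\<close> loses nothing. For empty \<open>T\<close>
  the value is unspecified.
\<close>
definition max_reduced_bound :: "'v set \<Rightarrow> 'v set \<Rightarrow> nat \<Rightarrow> ('v \<Rightarrow> enat) \<Rightarrow> nat" where
  "max_reduced_bound S T d b = the_enat (Max (reduced_bound S T d b ` T))"

text \<open>
  The truncated difference \<open>i - (d - 1)\<close> is the 0-based form of \<open>max {1, i - d + 1}\<close>.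
\<close>
definition selected_edges :: "nat \<Rightarrow> ('v \<times> 'v) set \<Rightarrow> 'v list \<Rightarrow> ('v \<times> 'v) set" where
  "selected_edges d Mhat xs =
     {(xs ! i, t) | i t. i < length xs \<and> (xs ! i, t) \<in> Mhat \<and>
        (\<forall>j\<in>{i - (d - 1)..<i}. (xs ! j, t) \<notin> Mhat)}"

text \<open>
  Output distribution of the randomized algorithm. The maximum-weight matching \<open>Mhat\<close>
  found in its first step is a parameter, as that step may return any such matching.
\<close>
definition random_order_algorithm ::
    "'v set \<Rightarrow> nat \<Rightarrow> ('v \<times> 'v) set \<Rightarrow> ('v list \<times> ('v \<times> 'v) set) pmf" where
  "random_order_algorithm S d Mhat =
     map_pmf (\<lambda>xs. (xs, selected_edges d Mhat xs)) (pmf_of_set (permutations_of_set S))"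

definition expected_weight ::
    "'v set \<Rightarrow> ('v \<times> 'v \<Rightarrow> real) \<Rightarrow> nat \<Rightarrow> ('v \<times> 'v) set \<Rightarrow> real" where
  "expected_weight S w d Mhat =
     measure_pmf.expectation (random_order_algorithm S d Mhat) (\<lambda>(xs, M). weight w M)"

definition factor_d :: "nat \<Rightarrow> real" where
  "factor_d d = (1 - 1 / real d) ^ (d - 1)"

text \<open>
  For \<open>k = 1\<close> the product with factor \<open>k - 1\<close> is read as 0, so the value is 1.
  For \<open>k = 0\<close> the value is 0, but then every \<open>b\<close>-matching for the reduced bounds is empty.
\<close>
definition factor_k :: "nat \<Rightarrow> real" where
  "factor_k k = (1 + (real k - 1) * (1 - 1 / (real k - 1)) ^ k) / real k"

text \<open>
  Tightness is stated with this predicate separately for each of the two terms of the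
  maximum: for fixed \<open>d\<close> and all large \<open>k\<close> it holds with \<open>c = factor_d d + \<epsilon>\<close>, and for
  fixed \<open>k\<close> and all large \<open>d\<close> with \<open>c = factor_k k + \<epsilon>\<close>. As both values are at most
  \<open>max (factor_d d) (factor_k k) + \<epsilon>\<close>, this is also tightness of the maximum. Equality for
  each single pair \<open>(d, k)\<close> is not claimed: it fails for \<open>d = k = 2\<close>.
\<close>
definition ratio_at_most_on_some_instance :: "nat \<Rightarrow> nat \<Rightarrow> real \<Rightarrow> bool" where
  "ratio_at_most_on_some_instance d k c \<longleftrightarrow>
     (\<exists>(S :: nat set) T E w b.
        bip_instance S T E w d \<and> max_reduced_bound S T d b = k \<and> 0 < optimum S T E w d b \<and>
        (\<forall>Mhat. max_weight_b_matching S T E w (reduced_bound S T d b) Mhat \<longrightarrow>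
           expected_weight S w d Mhat \<le> c * optimum S T E w d b))"

end

(* The reduced bounds lose nothing: at a node t a d-distance matching uses at most one position
   in each block of d consecutive positions, so Mhat weighs at least the optimum. It remains to
   bound the probability that an edge of Mhat at a node of degree m survives. Averaging the
   probability that the other m - 1 neighbours avoid the d - 1 preceding positions over the position
   of s gives exactly (1 + (m - 1) r) / m with r = C(n - d + 1, m) / C(n, m). The ratio r is a product
   of d - 1 factors 1 - m / (n - j), and also of m factors 1 - (d - 1) / (n - j). For (m - 1) d < n,
   the first form yields factor_d (by induction on the window length and Bernoulli's inequality),
   and the second yields factor_k for m = k (factor by factor), hence for all m up to k, as more
   neighbours only make survival less likely. On stars with n = (k - 1) d + 1 leaves, the
   same products bound the survival probability from above. *)
theory Submission
  imports Defs "HOL-Real_Asymp.Real_Asymp"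
begin

section \<open>Counting orderings\<close>

definition swap :: "nat \<Rightarrow> nat \<Rightarrow> 'a list \<Rightarrow> 'a list" where
  "swap i j xs = xs[i := xs ! j, j := xs ! i]"

lemma length_swap [simp]: "length (swap i j xs) = length xs"
  by (simp add: swap_def)

lemma nth_swap:
  "i < length xs \<Longrightarrow> j < length xs \<Longrightarrow>
     swap i j xs ! l = (if l = i then xs ! j else if l = j then xs ! i else xs ! l)"
  by (simp add: swap_def nth_list_update)

lemma swap_swap: "i < length xs \<Longrightarrow> j < length xs \<Longrightarrow> swap i j (swap j i xs) = xs"
  by (rule nth_equalityI) (auto simp: nth_swap)

lemma swap_permutations_of_set:
  "xs \<in> permutations_of_set S \<Longrightarrow> i < length xs \<Longrightarrow> j < length xs \<Longrightarrow>
     swap i j xs \<in> permutations_of_set S"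
  by (simp add: permutations_of_set_def swap_def)

lemma length_permutations_of_set: "xs \<in> permutations_of_set S \<Longrightarrow> length xs = card S"
  by (auto simp: permutations_of_set_def distinct_card)

text \<open>Symmetry replaces probability: swapping \<open>i\<close> and \<open>j\<close> is a
  bijection from the orderings in \<open>X\<close> with \<open>a\<close> at \<open>i\<close> to
  those with \<open>a\<close> at \<open>j\<close>. So \<open>a\<close> is equally frequent at all
  positions of \<open>U\<close>, and these classes partition \<open>X\<close>.\<close>

lemma card_nth_eq_swap_invariant:
  assumes X: "X \<subseteq> permutations_of_set S" and U: "U \<subseteq> {..<card S}"
    and swap: "\<And>xs i j. xs \<in> X \<Longrightarrow> i \<in> U \<Longrightarrow> j \<in> U \<Longrightarrow> swap i j xs \<in> X"
    and hit: "\<And>xs. xs \<in> X \<Longrightarrow> \<exists>j\<in>U. xs ! j = a"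
    and j: "j \<in> U"
  shows "card U * card {xs \<in> X. xs ! j = a} = card X"
proof -
  have len: "length xs = card S" "distinct xs" if "xs \<in> X" for xs
    using X that by (auto simp: permutations_of_set_def distinct_card)
  have finX: "finite X" and finU: "finite U"
    using X U finite_permutations_of_set[of S] by (auto intro: finite_subset)
  have eq: "card {xs \<in> X. xs ! i = a} = card {xs \<in> X. xs ! j = a}" if "i \<in> U" for i
  proof (rule bij_betw_same_card)
    have "i < card S" "j < card S" using that j U by auto
    then show "bij_betw (swap i j) {xs \<in> X. xs ! i = a} {xs \<in> X. xs ! j = a}"
      using that j swap len
      by (intro bij_betw_byWitness[where f' = "swap j i"]) (auto simp: swap_swap nth_swap)
  qed
  have "X = (\<Union>i\<in>U. {xs \<in> X. xs ! i = a})" using hit by auto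
  then have "card X = card (\<Union>i\<in>U. {xs \<in> X. xs ! i = a})" by simp
  also have "\<dots> = (\<Sum>i\<in>U. card {xs \<in> X. xs ! i = a})"
  proof (rule card_UN_disjoint)
    show "\<forall>i\<in>U. \<forall>j\<in>U. i \<noteq> j \<longrightarrow> {xs \<in> X. xs ! i = a} \<inter> {xs \<in> X. xs ! j = a} = {}"
    proof (intro ballI impI)
      fix i j assume *: "i \<in> U" "j \<in> U" "i \<noteq> j"
      then have "i < card S" "j < card S" using U by auto
      then show "{xs \<in> X. xs ! i = a} \<inter> {xs \<in> X. xs ! j = a} = {}"
        using * len by (auto simp: nth_eq_iff_index_eq)
    qed
  qed (use finX finU in auto)
  also have "\<dots> = card U * card {xs \<in> X. xs ! j = a}"
    using eq by simp
  finally show ?thesis by simp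
qed

text \<open>Given \<open>s\<close> at position \<open>i\<close>, the positions of \<open>A\<close>
  form a uniformly random subset of the other n - 1 positions, which misses \<open>W\<close> with
  probability C(n-1-|W|, |A|) / C(n-1, |A|). The equation is this ratio multiplied out; the
  induction adds one position of \<open>W\<close> at a time.\<close>

lemma card_permutations_avoiding:
  assumes S: "finite S" "s \<in> S" and A: "A \<subseteq> S - {s}" and i: "i < card S"
    and W: "W \<subseteq> {..<card S} - {i}"
  shows "card {xs \<in> permutations_of_set S. xs ! i = s \<and> (\<forall>j\<in>W. xs ! j \<notin> A)}
           * (card S - 1 choose card A) =
         fact (card S - 1) * (card S - 1 - card W choose card A)"
proof -
  have "finite W" using W by (rule finite_subset) simp
  then show ?thesis using W
  proof (induction W rule: finite_induct)
    case empty
    have "card {..<card S} * card {xs \<in> permutations_of_set S. xs ! i = s}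
            = card (permutations_of_set S)"
    proof (intro card_nth_eq_swap_invariant[where S = S])
      fix xs assume xs: "xs \<in> permutations_of_set S"
      then have "s \<in> set xs" using S by (simp add: permutations_of_setD)
      then show "\<exists>j\<in>{..<card S}. xs ! j = s"
        using xs by (auto simp: in_set_conv_nth length_permutations_of_set)
    qed (use i in \<open>auto simp: swap_permutations_of_set length_permutations_of_set\<close>)
    also have "\<dots> = card S * fact (card S - 1)"
      using S i by (simp add: fact_reduce)
    finally show ?case using i by simp
  next
    case (insert l W)
    define n where "n = card S"
    define X where "X = {xs \<in> permutations_of_set S. xs ! i = s \<and> (\<forall>j\<in>W. xs ! j \<notin> A)}"
    \<comment> \<open>Positions still open to elements of \<open>A\<close>. Swaps inside
      \<open>U\<close> neither move \<open>s\<close> nor touch \<open>W\<close>, so they preserve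
      \<open>X\<close>.\<close>
    define U where "U = {..<n} - insert i W"
    have lenX: "length xs = n" "distinct xs" "set xs = S" if "xs \<in> X" for xs
      using that by (auto simp: X_def n_def permutations_of_set_def distinct_card)
    have finX: "finite X" by (simp add: X_def)
    have finA: "finite A" using A S by (auto intro: finite_subset)
    have l: "l \<in> U" using insert by (auto simp: U_def n_def)
    have "card U = n - card (insert i W)"
      using insert i by (subst U_def, subst card_Diff_subset) (auto simp: n_def)
    moreover have "i \<notin> W" using insert by auto
    ultimately have cU: "card U = n - 1 - card W"
      using insert by simp
    have U: "U \<subseteq> {..<n}" by (auto simp: U_def)
    have count: "card U * card {xs \<in> X. xs ! l = a} = card X" if "a \<in> A" for a
    proof (rule card_nth_eq_swap_invariant[where S = S])
      fix xs assume xs: "xs \<in> X"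
      have "a \<in> set xs" using that A lenX[OF xs] by auto
      then obtain j where "j < n" "xs ! j = a" using lenX[OF xs] by (auto simp: in_set_conv_nth)
      moreover from this have "j \<notin> insert i W" using xs that A by (auto simp: X_def)
      ultimately show "\<exists>j\<in>U. xs ! j = a" by (auto simp: U_def)
    next
      fix xs j j' assume *: "xs \<in> X" "j \<in> U" "j' \<in> U"
      then have "j < n" "j' < n" using U by auto
      then show "swap j j' xs \<in> X"
        using * lenX[OF *(1)] by (auto simp: X_def U_def nth_swap swap_permutations_of_set)
    qed (use l U in \<open>auto simp: X_def n_def\<close>)
    \<comment> \<open>The orderings lost when \<open>l\<close> joins the window; by
      \<open>count\<close> they are the fraction \<open>card A / card U\<close> of
      \<open>X\<close>.\<close>
    define Z where "Z = (\<Union>a\<in>A. {xs \<in> X. xs ! l = a})"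
    have Z: "Z \<subseteq> X" by (auto simp: Z_def)
    have cZ: "card Z = (\<Sum>a\<in>A. card {xs \<in> X. xs ! l = a})"
      unfolding Z_def using finA finX by (intro card_UN_disjoint) auto
    have YZ: "{xs \<in> permutations_of_set S. xs ! i = s \<and> (\<forall>j\<in>insert l W. xs ! j \<notin> A)} = X - Z"
      (is "?Y = _") by (auto simp: X_def Z_def)
    have "card ?Y = card X - card Z"
      unfolding YZ by (rule card_Diff_subset[OF finite_subset[OF Z finX] Z])
    moreover have "card Z \<le> card X" by (rule card_mono[OF finX Z])
    ultimately have "real (card ?Y) = real (card X) - real (card Z)"
      by (simp only: of_nat_diff)
    moreover have "card U * card Z = card A * card X"
      unfolding cZ sum_distrib_left using count by simp
    then have "real (card U) * real (card Z) = real (card A) * real (card X)"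
      by (metis of_nat_mult)
    ultimately have Y: "real (card U) * real (card ?Y)
        = (real (card U) - real (card A)) * real (card X)"
      by (simp only: right_diff_distrib left_diff_distrib)
    have "card X * (n - 1 choose card A) = fact (n - 1) * (card U choose card A)"
      using insert by (simp add: X_def n_def cU)
    then have IH: "real (card X) * real (n - 1 choose card A)
        = fact (n - 1) * real (card U choose card A)"
      by (metis of_nat_mult of_nat_fact)
    \<comment> \<open>If \<open>card A > card U\<close>, the left factor is negative, but then both
      binomials vanish.\<close>
    have absorb: "(real (card U) - real (card A)) * real (card U choose card A)
        = real (card U) * real (card U - 1 choose card A)"
    proof (cases "card A \<le> card U")
      case True
      have "real (card U - card A) * real (card U choose card A)
          = real (card U) * real (card U - 1 choose card A)"
        using binomial_absorb_comp[of "card U" "card A"] by (metis of_nat_mult)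
      then show ?thesis using True by (simp only: of_nat_diff)
    qed (simp add: binomial_eq_0)
    have "real (card U) * (real (card ?Y) * real (n - 1 choose card A))
        = (real (card U) - real (card A)) * (real (card X) * real (n - 1 choose card A))"
      by (simp only: mult.assoc[symmetric] Y)
    also have "\<dots> = fact (n - 1) * ((real (card U) - real (card A)) * real (card U choose card A))"
      by (simp only: IH mult.left_commute)
    also have "\<dots> = real (card U) * (fact (n - 1) * real (card U - 1 choose card A))"
      by (simp only: absorb mult.left_commute)
    finally have "real (card U) * (real (card ?Y) * real (n - 1 choose card A))
        = real (card U) * (fact (n - 1) * real (card U - 1 choose card A))" .
    moreover have "real (card U) \<noteq> 0"
      using l finite_subset[OF U] by (auto simp: card_eq_0_iff)
    ultimately have "real (card ?Y) * real (n - 1 choose card A)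
        = fact (n - 1) * real (card U - 1 choose card A)"
      by (simp only: mult_cancel_left simp_thms)
    then have "real (card ?Y * (n - 1 choose card A)) = real (fact (n - 1) * (card U - 1 choose card A))"
      by (simp only: of_nat_mult of_nat_fact)
    then have "card ?Y * (n - 1 choose card A) = fact (n - 1) * (card U - 1 choose card A)"
      by (simp only: of_nat_eq_iff)
    moreover have "card U - 1 = card S - 1 - card (insert l W)"
      using insert by (simp add: n_def cU)
    ultimately show ?case by (simp only: n_def)
  qed
qed

section \<open>Survival probability of an edge, averaged over the position of its node\<close>

text \<open>Windows of the first \<open>D\<close> positions are cut off at the start, hence
  \<open>min i D\<close>. For \<open>D <= n\<close> their terms telescope by the hockey-stick
  identity, while the other \<open>n - D\<close> positions contribute equal terms, whose total
  becomes \<open>Suc a\<close> times a binomial by absorption.\<close>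

lemma sum_binomial_windows:
  "(\<Sum>i<n. n - 1 - min i D choose a) = (n choose Suc a) + a * (n - D choose Suc a)"
proof -
  have hockey: "(\<Sum>i<m. n - 1 - i choose a) + (n - m choose Suc a) = (n choose Suc a)"
    if "m \<le> n" for m
    using that
  proof (induction m)
    case (Suc m)
    then have "n - m = Suc (n - Suc m)" by simp
    then have "(n - m choose Suc a) = (n - 1 - m choose a) + (n - Suc m choose Suc a)"
      by simp
    then show ?case using Suc by simp
  qed simp
  show ?thesis
  proof (cases "D \<le> n")
    case True
    have "{..<n} = {..<D} \<union> {D..<n}" using True by auto
    then have "(\<Sum>i<n. n - 1 - min i D choose a)
      = (\<Sum>i<D. n - 1 - min i D choose a) + (\<Sum>i=D..<n. n - 1 - min i D choose a)"
      by (simp add: sum.union_disjoint ivl_disj_int)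
    also have "\<dots> = (\<Sum>i<D. n - 1 - i choose a) + (n - D) * (n - D - 1 choose a)"
      by simp
    also have "(n - D) * (n - D - 1 choose a) = Suc a * (n - D choose Suc a)"
      using Suc_times_binomial[of a "n - D - 1"] by (cases "n - D") auto
    finally show ?thesis using hockey[OF True] by simp
  next
    case False
    then show ?thesis using hockey[of n] by simp
  qed
qed

text \<open>The event that an edge from \<open>s\<close> survives: \<open>A\<close> stands for the
  other neighbours of its end in \<open>T\<close>, and \<open>D\<close> for
  \<open>d - 1\<close>.\<close>

definition separated_orderings :: "'a set \<Rightarrow> nat \<Rightarrow> 'a \<Rightarrow> 'a set \<Rightarrow> 'a list set" where
  "separated_orderings S D s A =
     {xs \<in> permutations_of_set S. \<exists>i<card S. xs ! i = s \<and> (\<forall>j\<in>{i - D..<i}. xs ! j \<notin> A)}"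

lemma separated_orderings_antimono:
  "A \<subseteq> B \<Longrightarrow> separated_orderings S D s B \<subseteq> separated_orderings S D s A"
  unfolding separated_orderings_def by blast

text \<open>The probability that the edge of a node \<open>s\<close> survives when its other end has \<open>m\<close> neighbours and
  the \<open>D\<close> preceding positions are inspected.\<close>
definition keep_prob :: "nat \<Rightarrow> nat \<Rightarrow> nat \<Rightarrow> real" where
  "keep_prob n D m = (1 + (real m - 1) * (real (n - D choose m) / real (n choose m))) / real m"

text \<open>The counts for the possible positions of \<open>s\<close> add up to the sum over
  windows; multiplying by \<open>n\<close> and absorbing \<open>n * (n - 1 choose a)\<close> gives
  the denominator of \<open>keep_prob\<close>. The \<open>Suc\<close> counts \<open>s\<close> itself
  as a neighbour.\<close>

lemma card_separated_orderings:
  assumes S: "finite S" "s \<in> S" and A: "A \<subseteq> S - {s}"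
  shows "real (card (separated_orderings S D s A)) / fact (card S)
           = keep_prob (card S) D (Suc (card A))"
proof -
  define n a where "n = card S" and "a = card A"
  have "n > 0" using S by (auto simp: n_def card_gt_0_iff)
  have finA: "finite A" using A S by (auto intro: finite_subset)
  have "card A < card S" using A S by (intro psubset_card_mono) auto
  then have a: "a < n" by (simp add: a_def n_def)
  define X where "X = (\<lambda>i. {xs \<in> permutations_of_set S. xs ! i = s \<and> (\<forall>j\<in>{i - D..<i}. xs ! j \<notin> A)})"
  have "separated_orderings S D s A = (\<Union>i<n. X i)"
    by (auto simp: separated_orderings_def X_def n_def)
  then have keep: "card (separated_orderings S D s A) = (\<Sum>i<n. card (X i))"
  proof (simp only:, intro card_UN_disjoint ballI impI)
    fix i j assume "i \<in> {..<n}" "j \<in> {..<n}" "i \<noteq> j"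
    then show "X i \<inter> X j = {}"
      using permutations_of_setD(2) length_permutations_of_set
      by (fastforce simp: X_def n_def nth_eq_iff_index_eq)
  qed (auto simp: X_def)
  have fixed: "card (X i) * (n - 1 choose a) = fact (n - 1) * (n - 1 - min i D choose a)"
    if "i < n" for i
  proof -
    have "card {i - D..<i} = min i D" by auto
    then show ?thesis
      using card_permutations_avoiding[OF S A, of i "{i - D..<i}"] that
      by (simp add: X_def n_def a_def subset_iff)
  qed
  have "card (separated_orderings S D s A) * (n - 1 choose a)
      = (\<Sum>i<n. fact (n - 1) * (n - 1 - min i D choose a))"
    unfolding keep sum_distrib_right by (intro sum.cong refl fixed) simp
  also have "\<dots> = fact (n - 1) * ((n choose Suc a) + a * (n - D choose Suc a))"
    by (simp only: sum_distrib_left[symmetric] sum_binomial_windows)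
  finally have "card (separated_orderings S D s A) * (n - 1 choose a)
      = fact (n - 1) * ((n choose Suc a) + a * (n - D choose Suc a))" .
  then have "card (separated_orderings S D s A) * (n * (n - 1 choose a))
      = (n * fact (n - 1)) * ((n choose Suc a) + a * (n - D choose Suc a))"
    by (metis mult.left_commute mult.assoc)
  moreover have "n * (n - 1 choose a) = Suc a * (n choose Suc a)"
    using Suc_times_binomial[of a "n - 1"] \<open>n > 0\<close> by simp
  moreover have "n * fact (n - 1) = fact n" using \<open>n > 0\<close> by (simp add: fact_reduce)
  ultimately have "card (separated_orderings S D s A) * (Suc a * (n choose Suc a))
      = fact n * ((n choose Suc a) + a * (n - D choose Suc a))" by (simp only:)
  then have "real (card (separated_orderings S D s A)) * (real (Suc a) * real (n choose Suc a))
      = fact n * (real (n choose Suc a) + real a * real (n - D choose Suc a))"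
    by (metis of_nat_mult of_nat_add of_nat_fact)
  moreover have C: "real (n choose Suc a) > 0" using a by simp
  ultimately have "real (card (separated_orderings S D s A)) / fact n
      = (real (n choose Suc a) + real a * real (n - D choose Suc a))
        / (real (Suc a) * real (n choose Suc a))"
    by (subst frac_eq_eq) (auto simp: mult.commute)
  also have "\<dots> = keep_prob n D (Suc a)"
    using C by (simp add: keep_prob_def add_divide_distrib)
  finally show ?thesis by (simp only: n_def a_def)
qed

section \<open>Bounds on the probability of keeping an edge\<close>

text \<open>Absorption gives C(N-1, m) = C(N, m) (1 - m/N) for N = n - D. This recursion underlies
  the product with one factor per window position.\<close>

lemma binomial_ratio_Suc:
  assumes "D < n"
  shows "real (n - Suc D choose m) / real (n choose m)
           = real (n - D choose m) / real (n choose m) * (1 - real m / real (n - D))"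
proof (cases "m \<le> n - D")
  case True
  define N where "N = n - D"
  have "real (N - m) * real (N choose m) = real N * real (N - 1 choose m)"
    using binomial_absorb_comp[of N m] by (metis of_nat_mult)
  moreover have "real N > 0" using assms by (simp add: N_def)
  ultimately have "real (N - 1 choose m) = real (N choose m) * (1 - real m / real N)"
    using True by (simp add: N_def[symmetric] of_nat_diff field_simps)
  then show ?thesis by (simp add: N_def)
qed (simp add: binomial_eq_0)

text \<open>With \<open>x = 1/d\<close> and \<open>D = j + 1\<close>, the second factor is
  \<open>d * (1 + j * x)\<close>. Bernoulli bounds it by \<open>d * (1 + x) ^ j\<close>, and
  \<open>(1 - x) * (1 + x) <= 1\<close> absorbs the powers.\<close>

lemma bernoulli_product_le_1:
  assumes "1 \<le> d"
  shows "(1 - 1 / real d) ^ D * (real d - 1 + real D) \<le> real d"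
proof (cases D)
  case (Suc j)
  define x where "x = 1 / real d"
  have x: "0 \<le> x" "x \<le> 1" "real d * x = 1" using assms by (auto simp: x_def)
  have "(1 - x) ^ D * (1 + real j * x) \<le> (1 - x) ^ D * (1 + x) ^ j"
    using x by (intro mult_left_mono Bernoulli_inequality) auto
  also have "\<dots> = (1 - x) * (1 - x * x) ^ j"
    by (simp add: Suc algebra_simps flip: power_mult_distrib)
  also have "\<dots> \<le> 1"
    using x by (intro mult_le_one power_le_one) (auto simp: mult_le_one)
  finally have "real d * ((1 - x) ^ D * (1 + real j * x)) \<le> real d * 1"
    by (intro mult_left_mono) auto
  moreover have "real d * (1 + real j * x) = real d + real j * (real d * x)"
    by (simp only: algebra_simps)
  then have "real d * (1 + real j * x) = real d - 1 + real D"
    by (simp add: x(3) Suc)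
  then have "real d * ((1 - x) ^ D * (1 + real j * x)) = (1 - x) ^ D * (real d - 1 + real D)"
    by (simp only: mult.left_commute[of "real d" "(1 - x) ^ D"])
  ultimately have "(1 - x) ^ D * (real d - 1 + real D) \<le> real d" by simp
  then show ?thesis by (simp only: x_def)
qed simp

text \<open>The bare ratio can drop below \<open>(1 - 1/d) ^ D\<close>, since a factor
  \<open>1 - m / (n - j)\<close> may be less than \<open>1 - 1/d\<close>. The summand 1 in
  \<open>keep_prob\<close> makes up for this, so the induction on \<open>D\<close> runs on the whole
  numerator.\<close>

lemma factor_d_le_keep_prob:
  assumes d: "1 \<le> d" and m: "1 \<le> m" and n: "(m - 1) * d < n"
  shows "factor_d d \<le> keep_prob n (d - 1) m"
proof (cases "m = 1")
  case True
  then show ?thesis using d by (simp add: factor_d_def keep_prob_def power_le_one)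
next
  case False
  define r where "r = (\<lambda>D. real (n - D choose m) / real (n choose m))"
  define y where "y = 1 - 1 / real d"
  have y: "0 \<le> y" using d by (simp add: y_def)
  have md: "real m * real d - real d + 1 \<le> real n"
  proof -
    have "(m - 1) * d + 1 \<le> n" using n by simp
    then have "real ((m - 1) * d + 1) \<le> real n" by (simp only: of_nat_le_iff)
    then show ?thesis using m by (simp add: of_nat_diff algebra_simps)
  qed
  have dn: "d < n"
  proof -
    have "d \<le> (m - 1) * d" using False m by (cases "m - 1") auto
    then show ?thesis using n by linarith
  qed
  have mn: "m \<le> n"
  proof -
    have "(m - 1) * 1 \<le> (m - 1) * d" using d by (intro mult_left_mono) auto
    then show ?thesis using n m by linarith
  qed
  have step: "real m * y ^ D \<le> 1 + (real m - 1) * r D" if "D \<le> d - 1" for D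
    using that
  proof (induction D)
    case 0
    have "(n choose m) > 0" using mn by simp
    then show ?case by (simp add: r_def)
  next
    case (Suc D)
    define N where "N = real (n - D)"
    have N: "N > 0" "N = real n - real D" using Suc dn by (auto simp: N_def)
    \<comment> \<open>Keeps \<open>1 - m / N\<close> nonnegative, so that the induction hypothesis
      can be multiplied by it.\<close>
    have mN: "real m \<le> N"
    proof -
      have "m - 2 \<le> (m - 2) * d" using d by simp
      moreover have "m - 1 = Suc (m - 2)" using False m by simp
      then have "(m - 1) * d = (m - 2) * d + d" by simp
      ultimately have "m + D \<le> n" using n Suc.prems False m by linarith
      then have "real (m + D) \<le> real n" by (simp only: of_nat_le_iff)
      then show ?thesis using N by simp
    qed
    have rS: "r (Suc D) = r D * (1 - real m / N)"
      unfolding r_def N_def by (rule binomial_ratio_Suc) (use Suc dn in simp)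
    have "y ^ D * (real m * real d - N) \<le> y ^ D * (real d - 1 + real D)"
      using y md N by (intro mult_left_mono) auto
    also have "\<dots> \<le> real d" unfolding y_def using d by (rule bernoulli_product_le_1)
    finally have key: "y ^ D * (real m * real d - N) \<le> real d" .
    have "real m * y ^ Suc D = real m * y ^ D * (1 - 1 / real d)" by (simp add: y_def)
    \<comment> \<open>Cleared of denominators this is \<open>key\<close>: the loss
      \<open>m * y ^ D * (m / N - 1 / d)\<close> is at most \<open>m / N\<close>.\<close>
    also have "\<dots> \<le> real m * y ^ D * (1 - real m / N) + real m / N"
    proof -
      have "real m * (y ^ D * (real m * real d - N)) \<le> real m * real d"
        using key by (intro mult_left_mono) auto
      then have "real m * (y ^ D * (real m * real d - N)) / (N * real d) \<le> real m * real d / (N * real d)"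
        using N by (intro divide_right_mono) auto
      moreover have "real m * (y ^ D * (real m * real d - N)) / (N * real d)
          = real m * y ^ D * (real m / N - 1 / real d)"
        using N(1) d by (simp add: field_simps)
      moreover have "real m * real d / (N * real d) = real m / N" using d by simp
      ultimately show ?thesis by (simp add: algebra_simps)
    qed
    also have "\<dots> \<le> (1 + (real m - 1) * r D) * (1 - real m / N) + real m / N"
      using Suc mN N by (intro add_right_mono mult_right_mono) auto
    also have "\<dots> = 1 + (real m - 1) * r (Suc D)"
      by (simp add: rS algebra_simps diff_divide_distrib)
    finally show ?case .
  qed
  show ?thesis
    using step[of "d - 1"] m by (simp add: factor_d_def keep_prob_def r_def y_def field_simps)
qed

text \<open>Follows from (m+1) C(N, m+1) = C(N, m) (N - m) for N = n - D and N = n. This recursion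
  in \<open>m\<close> underlies the product with one factor per neighbour.\<close>

lemma binomial_ratio_product:
  assumes "m \<le> n"
  shows "real (n - D choose Suc m) / real (n choose Suc m)
           = real (n - D choose m) / real (n choose m) * ((real (n - D) - real m) / (real n - real m))"
proof -
  have *: "real (Suc m) * real (N choose Suc m) = real (N choose m) * (real N - real m)" for N
  proof (cases "m \<le> N")
    case True
    have "Suc m * (N choose Suc m) = (N - m) * (N choose m)"
      by (simp only: binomial_absorption binomial_absorb_comp)
    then have "real (Suc m) * real (N choose Suc m) = real (N - m) * real (N choose m)"
      by (metis of_nat_mult)
    then show ?thesis using True by (simp only: of_nat_diff mult.commute)
  qed (simp add: binomial_eq_0)
  have "real (n - D choose Suc m) / real (n choose Suc m)
    = (real (Suc m) * real (n - D choose Suc m)) / (real (Suc m) * real (n choose Suc m))"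
    by simp
  then show ?thesis unfolding * by simp
qed

text \<open>For \<open>k > 1\<close>, the factors are \<open>1 - (d - 1) / (n - j)\<close> with
  \<open>j <= k - 1\<close>. As \<open>n >= (k - 1) * d + 1\<close>, each is at least
  \<open>1 - 1 / (k - 1)\<close>.\<close>

lemma factor_k_le_keep_prob:
  assumes d: "1 \<le> d" and k: "1 \<le> k" and n: "(k - 1) * d < n"
  shows "factor_k k \<le> keep_prob n (d - 1) k"
proof (cases "k = 1")
  case True
  then show ?thesis by (simp add: factor_k_def keep_prob_def)
next
  case False
  define a where "a = real k - 1"
  have a: "a \<ge> 1" using k False by (simp add: a_def)
  have ad: "a * real d + 1 \<le> real n"
  proof -
    have "(k - 1) * d + 1 \<le> n" using n by simp
    then have "real ((k - 1) * d + 1) \<le> real n" by (simp only: of_nat_le_iff)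
    then show ?thesis using k by (simp add: a_def of_nat_diff algebra_simps)
  qed
  have "a * 1 \<le> a * real d" using d a by (intro mult_left_mono) auto
  then have kn: "real k \<le> real n" using ad by (simp add: a_def)
  have "1 * real d \<le> a * real d" using a by (intro mult_right_mono) auto
  then have dn: "d \<le> n" using ad by linarith
  have "(1 - 1 / a) ^ j \<le> real (n - (d - 1) choose j) / real (n choose j)" if "j \<le> k" for j
    using that
  proof (induction j)
    case (Suc j)
    have j: "real j \<le> a" "real j < real n" using Suc.prems kn by (auto simp: a_def)
    have "a * (real d - 1) \<le> real n - real j" using ad j by (simp add: algebra_simps)
    then have "(real d - 1) / (real n - real j) \<le> 1 / a"
      using a j by (simp add: field_simps)
    then have "1 - 1 / a \<le> 1 - (real d - 1) / (real n - real j)" by simp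
    also have "\<dots> = (real (n - (d - 1)) - real j) / (real n - real j)"
      using j d dn by (simp add: of_nat_diff field_simps)
    finally have "(1 - 1 / a) ^ j * (1 - 1 / a) \<le> real (n - (d - 1) choose j) / real (n choose j)
        * ((real (n - (d - 1)) - real j) / (real n - real j))"
      using Suc a by (intro mult_mono) auto
    then show ?case using j by (simp add: binomial_ratio_product mult.commute)
  qed simp
  from this[of k] show ?thesis
    using a k unfolding factor_k_def keep_prob_def a_def
    by (intro divide_right_mono add_left_mono mult_left_mono) auto
qed

section \<open>Upper bounds for \<open>n = (k - 1) * d + 1\<close>\<close>

text \<open>Here \<open>n <= k * d\<close>, so each factor \<open>1 - k / (n - j)\<close> is at most
  \<open>1 - 1/d\<close>. The first summand of \<open>keep_prob\<close> is the error
  \<open>1/k\<close>, which vanishes for large \<open>k\<close>.\<close>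

lemma keep_prob_le_factor_d:
  assumes d: "1 \<le> d" and k: "1 \<le> k" and n: "n = (k - 1) * d + 1"
  shows "keep_prob n (d - 1) k \<le> factor_d d + 1 / real k"
proof -
  have nr: "real n = (real k - 1) * real d + 1" using n k by (simp add: of_nat_diff)
  have le: "real (n - D choose k) / real (n choose k) \<le> (1 - 1 / real d) ^ D" if "D < n" for D
    using that
  proof (induction D)
    case 0
    then show ?case by simp
  next
    case (Suc D)
    have "real n \<le> real k * real d" using nr d by (simp add: algebra_simps)
    then have "real (n - D) \<le> real k * real d" by linarith
    then have "1 - real k / real (n - D) \<le> 1 - 1 / real d"
      using Suc.prems d by (simp add: field_simps)
    then have "real (n - D choose k) / real (n choose k) * (1 - real k / real (n - D))
      \<le> (1 - 1 / real d) ^ D * (1 - 1 / real d)"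
      using Suc d
      \<comment> \<open>\<open>1 - k / (n - D)\<close> may be negative, so it is raised to
        \<open>1 - 1/d\<close> first, against the nonnegative ratio; only then is the ratio
        raised.\<close>
      by (intro order_trans[OF mult_left_mono[of _ "1 - 1 / real d"] mult_right_mono]) auto
    then show ?case using Suc.prems by (subst binomial_ratio_Suc) (auto simp: mult.commute)
  qed
  have "(real k - 1) * (real (n - (d - 1) choose k) / real (n choose k)) \<le> real k * factor_d d"
  proof (cases "k = 1")
    case False
    have "d \<le> (k - 1) * d" using False k by (cases "k - 1") auto
    then have "d - 1 < n" using n by linarith
    with le have "real (n - (d - 1) choose k) / real (n choose k) \<le> factor_d d"
      by (simp add: factor_d_def)
    then show ?thesis using k by (intro mult_mono) auto
  qed (use d in \<open>simp add: factor_d_def\<close>)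
  then have "keep_prob n (d - 1) k \<le> (1 + real k * factor_d d) / real k"
    unfolding keep_prob_def by (intro divide_right_mono add_left_mono) auto
  then show ?thesis using k by (simp add: add_divide_distrib)
qed

text \<open>Each factor \<open>1 - (d - 1) / (n - j)\<close> is at most its value at
  \<open>j = 0\<close>. Writing \<open>n\<close> out in \<open>d\<close> prepares the limit in
  \<open>d\<close> for fixed \<open>k\<close>.\<close>

lemma keep_prob_le_power:
  assumes d: "1 \<le> d" and k: "1 \<le> k" and n: "n = (k - 1) * d + 1"
  shows "keep_prob n (d - 1) k
           \<le> (1 + (real k - 1) * (1 - (real d - 1) / ((real k - 1) * real d + 1)) ^ k) / real k"
proof (cases "k = 1")
  case True
  then show ?thesis by (simp add: keep_prob_def)
next
  case False
  have "d \<le> (k - 1) * d" using False k by (cases "k - 1") auto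
  then have dn: "d \<le> n" using n by linarith
  have "(k - 1) * 1 \<le> (k - 1) * d" using d by (intro mult_left_mono) auto
  then have kn: "k \<le> n" using n k by linarith
  have nr: "(real k - 1) * real d + 1 = real n" using n k by (simp add: of_nat_diff)
  define D where "D = d - 1"
  have D: "real d - 1 = real D" "D < n" using d dn by (auto simp: D_def of_nat_diff)
  have "real (n - D choose j) / real (n choose j) \<le> (1 - real D / real n) ^ j" if "j \<le> k" for j
    using that
  proof (induction j)
    case (Suc j)
    have j: "real j < real n" using Suc.prems kn by simp
    have "(real (n - D) - real j) / (real n - real j) = 1 - real D / (real n - real j)"
      using j D by (simp add: of_nat_diff field_simps)
    also have "\<dots> \<le> 1 - real D / real n"
      using j D by (intro diff_left_mono divide_left_mono) auto
    finally have "real (n - D choose j) / real (n choose j)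
        * ((real (n - D) - real j) / (real n - real j)) \<le> (1 - real D / real n) ^ j * (1 - real D / real n)"
      using Suc D
      by (intro order_trans[OF mult_left_mono[of _ "1 - real D / real n"] mult_right_mono]) auto
    then show ?case using j by (simp add: binomial_ratio_product mult.commute)
  qed simp
  from this[of k] show ?thesis
    unfolding nr D(1) keep_prob_def D_def[symmetric] using k
    by (intro divide_right_mono add_left_mono mult_left_mono) auto
qed

section \<open>The algorithm\<close>

definition neighbours :: "('v \<times> 'v) set \<Rightarrow> 'v \<Rightarrow> 'v set" where
  "neighbours M t = {s. (s, t) \<in> M}"

lemma edge_degree_T:
  assumes "M \<subseteq> S \<times> T" "S \<inter> T = {}" "t \<in> T"
  shows "edge_degree M t = card (neighbours M t)"
proof -
  have "{e \<in> M. fst e = t \<or> snd e = t} = (\<lambda>s. (s, t)) ` neighbours M t"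
    using assms by (auto simp: neighbours_def)
  then show ?thesis by (simp add: edge_degree_def card_image inj_on_def)
qed

lemma edge_degree_mono: "M \<subseteq> M' \<Longrightarrow> finite M' \<Longrightarrow> edge_degree M v \<le> edge_degree M' v"
  unfolding edge_degree_def by (intro card_mono) auto

lemma bip_instance_finite_edges: "bip_instance S T E w d \<Longrightarrow> finite E"
  unfolding bip_instance_def by (metis finite_SigmaI finite_subset)

lemma b_matching_subset:
  assumes "b_matching S T E b M" "M' \<subseteq> M" "finite M"
  shows "b_matching S T E b M'"
  unfolding b_matching_def
proof (intro conjI ballI)
  fix v assume "v \<in> S \<union> T"
  then have "enat (edge_degree M v) \<le> b v" using assms by (auto simp: b_matching_def)
  moreover have "enat (edge_degree M' v) \<le> enat (edge_degree M v)"
    using edge_degree_mono[OF assms(2,3)] by simp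
  ultimately show "enat (edge_degree M' v) \<le> b v" by (rule order_trans[rotated])
qed (use assms in \<open>auto simp: b_matching_def\<close>)

lemma b_matching_mono:
  "b_matching S T E b M \<Longrightarrow> (\<And>v. b v \<le> b' v) \<Longrightarrow> b_matching S T E b' M"
  unfolding b_matching_def by (meson order_trans)

lemma reduced_bound_le: "reduced_bound S T d b v \<le> b v"
  by (simp add: reduced_bound_def)

section \<open>Feasibility of the output, and the reduced bounds as a relaxation\<close>

text \<open>Of two edges of \<open>Mhat\<close> at the same \<open>t\<close> that are closer than
  \<open>d\<close>, the earlier one lies in the window of the later one, which is therefore
  dropped.\<close>

lemma distance_b_matching_selected_edges:
  assumes G: "bip_instance S T E w d"
    and M: "b_matching S T E (reduced_bound S T d b) Mhat"
    and xs: "xs \<in> permutations_of_set S"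
  shows "distance_b_matching S T E d b xs (selected_edges d Mhat xs)"
  unfolding distance_b_matching_def
proof (intro conjI allI impI)
  have fin: "finite Mhat"
    using M bip_instance_finite_edges[OF G] finite_subset unfolding b_matching_def by blast
  have "b_matching S T E b Mhat"
    using M reduced_bound_le by (rule b_matching_mono)
  then show "b_matching S T E b (selected_edges d Mhat xs)"
    by (rule b_matching_subset) (use fin in \<open>auto simp: selected_edges_def\<close>)
next
  fix i j t
  assume i: "i < length xs" and j: "j < length xs"
    and ij: "(xs ! i, t) \<in> selected_edges d Mhat xs \<and> (xs ! j, t) \<in> selected_edges d Mhat xs \<and> i \<noteq> j"
  \<comment> \<open>\<open>selected_edges\<close> hides the index; distinctness of \<open>xs\<close>
    recovers it from the node.\<close>
  have sel: "(xs ! l, t) \<in> Mhat \<and> (\<forall>l'\<in>{l - (d - 1)..<l}. (xs ! l', t) \<notin> Mhat)"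
    if "l < length xs" "(xs ! l, t) \<in> selected_edges d Mhat xs" for l
    using that permutations_of_setD(2)[OF xs] by (auto simp: selected_edges_def nth_eq_iff_index_eq)
  have "i \<notin> {j - (d - 1)..<j}" "j \<notin> {i - (d - 1)..<i}"
    using sel[OF i] sel[OF j] ij by auto
  then show "int d \<le> \<bar>int i - int j\<bar>" using ij by auto
qed

lemma distance_b_matching_imp_b_matching:
  assumes G: "bip_instance S T E w d" and xs: "xs \<in> permutations_of_set S"
    and M: "distance_b_matching S T E d b xs M"
  shows "b_matching S T E (reduced_bound S T d b) M"
  unfolding b_matching_def
proof (intro conjI ballI)
  have bM: "b_matching S T E b M" using M by (simp add: distance_b_matching_def)
  then show "M \<subseteq> E" by (simp add: b_matching_def)
  fix v assume v: "v \<in> S \<union> T"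
  have bv: "enat (edge_degree M v) \<le> b v" using bM v by (simp add: b_matching_def)
  show "enat (edge_degree M v) \<le> reduced_bound S T d b v"
  proof (cases "v \<in> T")
    case True
    have d: "d \<ge> 1" and MST: "M \<subseteq> S \<times> T" "S \<inter> T = {}"
      using G bM by (auto simp: bip_instance_def b_matching_def)
    define I where "I = {i. i < length xs \<and> (xs ! i, v) \<in> M}"
    define N where "N = nat \<lceil>real (card S) / real d\<rceil>"
    have "neighbours M v = (\<lambda>i. xs ! i) ` I"
    proof (intro equalityI subsetI)
      fix s assume s: "s \<in> neighbours M v"
      then have "s \<in> set xs"
        using MST permutations_of_setD(1)[OF xs] by (auto simp: neighbours_def)
      then obtain i where "i < length xs" "xs ! i = s" by (auto simp: in_set_conv_nth)
      then show "s \<in> (\<lambda>i. xs ! i) ` I" using s by (auto simp: I_def neighbours_def)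
    qed (auto simp: I_def neighbours_def)
    then have "edge_degree M v \<le> card I"
      using edge_degree_T[OF MST True] by (simp add: card_image_le I_def)
    also have "card I \<le> card {..<N}"
    proof (rule card_inj_on_le)
      \<comment> \<open>\<open>i div d\<close> is the block of position \<open>i\<close>: two
        positions in one block differ by less than \<open>d\<close>, and there are \<open>N\<close>
        blocks.\<close>
      show "inj_on (\<lambda>i. i div d) I"
      proof (rule inj_onI, rule ccontr)
        fix i j assume *: "i \<in> I" "j \<in> I" "i div d = j div d" "i \<noteq> j"
        then have "int d \<le> \<bar>int i - int j\<bar>"
          using M by (auto simp: distance_b_matching_def I_def)
        moreover have "i = (i div d) * d + i mod d" "j = (i div d) * d + j mod d"
          by (simp, simp only: *(3) div_mult_mod_eq)
        moreover have "i mod d < d" "j mod d < d" using d by auto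
        ultimately show False by linarith
      qed
      show "(\<lambda>i. i div d) ` I \<subseteq> {..<N}"
      proof clarsimp
        fix i assume "i \<in> I"
        then have "i < card S" using length_permutations_of_set[OF xs] by (simp add: I_def)
        then have "real i / real d < real (card S) / real d" using d by (simp add: divide_strict_right_mono)
        moreover have "real (i div d) \<le> real i / real d" by (rule of_nat_div_le_of_nat)
        ultimately have "real (i div d) < real (card S) / real d" by linarith
        then show "i div d < N" unfolding N_def by linarith
      qed
    qed simp
    finally have "edge_degree M v \<le> N" by simp
    then show ?thesis using bv True by (simp add: reduced_bound_def N_def)
  qed (use bv in \<open>simp add: reduced_bound_def\<close>)
qed

lemma finite_distance_b_matchings:
  assumes "bip_instance S T E w d"
  shows "finite {M. distance_b_matching S T E d b xs M}"
proof (rule finite_subset)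
  show "{M. distance_b_matching S T E d b xs M} \<subseteq> Pow E"
    by (auto simp: distance_b_matching_def b_matching_def)
qed (use bip_instance_finite_edges[OF assms] in simp)

lemma weight_le_optimum:
  assumes G: "bip_instance S T E w d" and xs: "xs \<in> permutations_of_set S"
    and M: "distance_b_matching S T E d b xs M"
  shows "weight w M \<le> optimum S T E w d b"
proof -
  have "weight w M \<le> heaviest_weight S T E w d b xs"
    unfolding heaviest_weight_def using M finite_distance_b_matchings[OF G]
    by (intro Max_ge) auto
  also have "\<dots> \<le> optimum S T E w d b"
    unfolding optimum_def using xs by (intro Max_ge) auto
  finally show ?thesis .
qed

lemma optimum_le_max_weight:
  assumes G: "bip_instance S T E w d"
    and M: "max_weight_b_matching S T E w (reduced_bound S T d b) Mhat"
  shows "optimum S T E w d b \<le> weight w Mhat"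
  unfolding optimum_def
proof (rule Max.boundedI)
  show "heaviest_weight S T E w d b ` permutations_of_set S \<noteq> {}"
    using G by (simp add: bip_instance_def)
  fix h assume "h \<in> heaviest_weight S T E w d b ` permutations_of_set S"
  then obtain xs where xs: "xs \<in> permutations_of_set S" and h: "h = heaviest_weight S T E w d b xs"
    by auto
  show "h \<le> weight w Mhat"
    unfolding h heaviest_weight_def
  proof (rule Max.boundedI)
    have "distance_b_matching S T E d b xs {}"
      by (auto simp: distance_b_matching_def b_matching_def edge_degree_def simp flip: zero_enat_def)
    then show "weight w ` {M. distance_b_matching S T E d b xs M} \<noteq> {}" by auto
  next
    fix x assume "x \<in> weight w ` {M. distance_b_matching S T E d b xs M}"
    then show "x \<le> weight w Mhat"
      using M distance_b_matching_imp_b_matching[OF G xs] by (auto simp: max_weight_b_matching_def)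
  qed (simp add: finite_distance_b_matchings[OF G])
qed simp

section \<open>Expected weight of the output\<close>

text \<open>Removing \<open>s\<close> from the neighbours of \<open>t\<close> changes nothing, since
  \<open>s\<close> occurs only once in \<open>xs\<close>. It gives the avoided set the form that the
  count requires, a subset of \<open>S - {s}\<close>.\<close>

lemma selected_edges_eq:
  assumes "xs \<in> permutations_of_set S"
  shows "(s, t) \<in> selected_edges d M xs \<longleftrightarrow>
    (s, t) \<in> M \<and> xs \<in> separated_orderings S (d - 1) s (neighbours M t - {s})"
proof -
  have len: "length xs = card S" and dist: "distinct xs"
    using assms by (auto simp: length_permutations_of_set permutations_of_setD)
  have "xs ! j \<noteq> xs ! i" if "i < card S" "j < i" for i j
    using that len dist by (simp add: nth_eq_iff_index_eq)
  then have "(\<forall>j\<in>{i - (d - 1)..<i}. (xs ! j, t) \<notin> M) \<longleftrightarrow>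
      (\<forall>j\<in>{i - (d - 1)..<i}. xs ! j \<notin> neighbours M t - {xs ! i})" if "i < card S" for i
    using that by (auto simp: neighbours_def)
  moreover have "(s, t) \<in> selected_edges d M xs \<longleftrightarrow>
      (\<exists>i<card S. xs ! i = s \<and> (s, t) \<in> M \<and> (\<forall>j\<in>{i - (d - 1)..<i}. (xs ! j, t) \<notin> M))"
    by (auto simp: selected_edges_def len)
  moreover have "xs \<in> separated_orderings S (d - 1) s (neighbours M t - {s}) \<longleftrightarrow>
      (\<exists>i<card S. xs ! i = s \<and> (\<forall>j\<in>{i - (d - 1)..<i}. xs ! j \<notin> neighbours M t - {xs ! i}))"
    using assms by (auto simp: separated_orderings_def)
  ultimately show ?thesis by blast
qed

text \<open>Linearity of expectation: exchanging the sums over orderings and edges leaves, for each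
  edge, the number of orderings that keep it.\<close>

lemma expected_weight_eq:
  assumes S: "finite S" and M: "finite M" "M \<subseteq> S \<times> T"
  shows "expected_weight S w d M =
    (\<Sum>(s, t)\<in>M. w (s, t) * keep_prob (card S) (d - 1) (card (neighbours M t)))"
proof -
  define P where "P = permutations_of_set S"
  have P: "finite P" "P \<noteq> {}" "card P = fact (card S)" using S by (auto simp: P_def)
  have sel: "selected_edges d M xs = {e \<in> M. e \<in> selected_edges d M xs}" for xs
    by (auto simp: selected_edges_def)
  have w: "weight w (selected_edges d M xs) = (\<Sum>e\<in>M. if e \<in> selected_edges d M xs then w e else 0)" for xs
    unfolding weight_def by (subst sel, rule sum.inter_filter[OF M(1)])
  have "expected_weight S w d M = (\<Sum>xs\<in>P. weight w (selected_edges d M xs)) / fact (card S)"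
    using P(1,2) unfolding expected_weight_def random_order_algorithm_def P_def[symmetric]
    by (simp add: integral_pmf_of_set P(3))
  also have "\<dots> = (\<Sum>e\<in>M. (\<Sum>xs\<in>P. if e \<in> selected_edges d M xs then w e else 0)) / fact (card S)"
    unfolding w by (subst sum.swap) simp
  also have "\<dots> = (\<Sum>e\<in>M. w e * (real (card {xs \<in> P. e \<in> selected_edges d M xs}) / fact (card S)))"
    using P(1) by (simp add: sum_divide_distrib sum.inter_filter[symmetric] mult.commute)
  also have "\<dots> = (\<Sum>(s, t)\<in>M. w (s, t) * keep_prob (card S) (d - 1) (card (neighbours M t)))"
  proof (intro sum.cong refl, clarify)
    fix s t assume st: "(s, t) \<in> M"
    have N: "neighbours M t \<subseteq> S" "s \<in> neighbours M t" using st M by (auto simp: neighbours_def)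
    then have fin: "finite (neighbours M t)" using S finite_subset by blast
    have "{xs \<in> P. (s, t) \<in> selected_edges d M xs}
        = separated_orderings S (d - 1) s (neighbours M t - {s})"
      using st by (simp add: P_def selected_edges_eq cong: conj_cong)
        (auto simp: separated_orderings_def)
    moreover have "real (card (separated_orderings S (d - 1) s (neighbours M t - {s}))) / fact (card S)
        = keep_prob (card S) (d - 1) (card (neighbours M t))"
      using card_separated_orderings[OF S, of s "neighbours M t - {s}" "d - 1"]
        card_Suc_Diff1[OF fin N(2)] N by auto
    ultimately show "w (s, t) * (real (card {xs \<in> P. (s, t) \<in> selected_edges d M xs}) / fact (card S))
        = w (s, t) * keep_prob (card S) (d - 1) (card (neighbours M t))"
      by (simp only:)
  qed
  finally show ?thesis .
qed

text \<open>A model replaces algebra: \<open>keep_prob n D l\<close> is the survival probability for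
  node 0 of \<open>{..<n}\<close> with other neighbours \<open>{1..<l}\<close>, and a larger set to
  avoid leaves fewer orderings.\<close>

lemma keep_prob_antimono:
  assumes "1 \<le> m" "m \<le> k" "k \<le> n"
  shows "keep_prob n D k \<le> keep_prob n D m"
proof -
  define S where "S = {..<n}"
  define A :: "nat \<Rightarrow> nat set" where "A = (\<lambda>l. {1..<l})"
  have S: "finite S" "0 \<in> S" "card S = n" using assms by (auto simp: S_def)
  have A: "A l \<subseteq> S - {0}" "Suc (card (A l)) = l" if "1 \<le> l" "l \<le> n" for l
    using that by (auto simp: A_def S_def)
  have "A m \<subseteq> A k" using assms by (auto simp: A_def)
  then have "card (separated_orderings S D 0 (A k)) \<le> card (separated_orderings S D 0 (A m))"
    by (intro card_mono separated_orderings_antimono) (simp add: separated_orderings_def)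
  then have "real (card (separated_orderings S D 0 (A k))) / fact n
      \<le> real (card (separated_orderings S D 0 (A m))) / fact n"
    by (intro divide_right_mono) auto
  then show ?thesis
    using card_separated_orderings[OF S(1,2) A(1), of m D] card_separated_orderings[OF S(1,2) A(1), of k D]
      A(2)[of m] A(2)[of k] assms S(3) by simp
qed

text \<open>The bound by \<open>factor_d\<close> applies to \<open>m\<close> itself, as
  \<open>(m - 1) * d < n\<close> is inherited from \<open>k\<close>. The bound by
  \<open>factor_k\<close> is available at \<open>k\<close>, and monotonicity carries it down to
  \<open>m\<close>.\<close>

lemma max_factor_le_keep_prob:
  assumes d: "1 \<le> d" and m: "1 \<le> m" "m \<le> k" and n: "(k - 1) * d < n"
  shows "max (factor_d d) (factor_k k) \<le> keep_prob n (d - 1) m"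
proof -
  have "(m - 1) * d \<le> (k - 1) * d" using m by (intro mult_right_mono) auto
  then have "factor_d d \<le> keep_prob n (d - 1) m"
    using n by (intro factor_d_le_keep_prob d m) linarith
  moreover have "(k - 1) * 1 \<le> (k - 1) * d" using d by (intro mult_left_mono) auto
  then have "k \<le> n" using n by linarith
  then have "factor_k k \<le> keep_prob n (d - 1) m"
    using keep_prob_antimono[OF m, of n] factor_k_le_keep_prob[OF d _ n] m by (meson order_trans)
  ultimately show ?thesis by simp
qed

text \<open>The maximum \<open>k\<close> is at most the ceiling of \<open>n / d\<close>, so
  \<open>k - 1 < n / d\<close>. The node \<open>t\<close> with its positive bound ensures
  \<open>k >= 1\<close>, so the subtraction is not truncated.\<close>

lemma max_reduced_bound_bounds:
  assumes G: "bip_instance S T E w d" and t: "t \<in> T"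
    and m: "enat m \<le> reduced_bound S T d b t" "1 \<le> m"
  shows "m \<le> max_reduced_bound S T d b"
    and "(max_reduced_bound S T d b - 1) * d < card S"
proof -
  define k where "k = max_reduced_bound S T d b"
  define N where "N = nat \<lceil>real (card S) / real d\<rceil>"
  define R where "R = Max (reduced_bound S T d b ` T)"
  have T: "finite T" and d: "1 \<le> d" using G by (auto simp: bip_instance_def)
  have "R \<le> enat N"
    unfolding R_def using T t by (subst Max_le_iff) (auto simp: reduced_bound_def N_def)
  then have kR: "enat k = R" unfolding k_def max_reduced_bound_def R_def[symmetric]
    by (cases R) auto
  have "enat m \<le> R" using m T t unfolding R_def by (meson Max_ge finite_imageI imageI order_trans)
  then show mk: "m \<le> max_reduced_bound S T d b" unfolding kR[symmetric] k_def by simp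
  have "k \<le> N" using \<open>R \<le> enat N\<close> unfolding kR[symmetric] by simp
  moreover have "1 \<le> k" using mk m by (simp add: k_def)
  ultimately have "real (k - 1) < real (card S) / real d" unfolding N_def by linarith
  then have "real ((k - 1) * d) < real (card S)" using d by (simp add: field_simps)
  then show "(max_reduced_bound S T d b - 1) * d < card S"
    unfolding k_def by (simp only: of_nat_less_iff)
qed

text \<open>Each edge of \<open>Mhat\<close> survives with probability at least \<open>c\<close>,
  its degree at \<open>t\<close> being between 1 and the maximal reduced bound. For empty
  \<open>T\<close>, where that maximum is unspecified, \<open>Mhat\<close> is empty and so is the
  sum.\<close>

lemma expected_weight_ge:
  assumes G: "bip_instance S T E w d"
    and M: "max_weight_b_matching S T E w (reduced_bound S T d b) Mhat"
  shows "max (factor_d d) (factor_k (max_reduced_bound S T d b)) * optimum S T E w d b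
           \<le> expected_weight S w d Mhat"
proof -
  define c where "c = max (factor_d d) (factor_k (max_reduced_bound S T d b))"
  have S: "finite S" and E: "E \<subseteq> S \<times> T" and ST: "S \<inter> T = {}" and d: "1 \<le> d"
    and w: "\<And>e. e \<in> E \<Longrightarrow> 0 \<le> w e"
    using G by (auto simp: bip_instance_def)
  have ME: "Mhat \<subseteq> E" and bM: "b_matching S T E (reduced_bound S T d b) Mhat"
    using M by (auto simp: max_weight_b_matching_def b_matching_def)
  have fin: "finite Mhat" using ME bip_instance_finite_edges[OF G] by (rule finite_subset)
  have MST: "Mhat \<subseteq> S \<times> T" using ME E by (rule order_trans)
  \<comment> \<open>The sign of \<open>c\<close> comes from \<open>factor_d\<close> alone, whatever
    the value of \<open>factor_k\<close>.\<close>
  have "0 \<le> factor_d d" using d by (simp add: factor_d_def)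
  then have "0 \<le> c" by (simp add: c_def)
  then have "c * optimum S T E w d b \<le> c * weight w Mhat"
    using optimum_le_max_weight[OF G M] by (rule mult_left_mono[rotated])
  also have "\<dots> = (\<Sum>e\<in>Mhat. w e * c)"
    by (simp add: weight_def sum_distrib_left mult.commute)
  also have "\<dots> \<le> (\<Sum>(s, t)\<in>Mhat. w (s, t) * keep_prob (card S) (d - 1) (card (neighbours Mhat t)))"
  proof (rule sum_mono, clarify)
    fix s t assume st: "(s, t) \<in> Mhat"
    then have t: "t \<in> T" and s: "s \<in> neighbours Mhat t" using MST by (auto simp: neighbours_def)
    have "neighbours Mhat t \<subseteq> S" using MST by (auto simp: neighbours_def)
    then have "finite (neighbours Mhat t)" using S finite_subset by blast
    then have m: "1 \<le> card (neighbours Mhat t)" using s by (auto simp: Suc_le_eq card_gt_0_iff)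
    have "enat (card (neighbours Mhat t)) \<le> reduced_bound S T d b t"
      using bM t unfolding b_matching_def edge_degree_T[OF MST ST t, symmetric] by blast
    from max_reduced_bound_bounds[OF G t this m]
    have "c \<le> keep_prob (card S) (d - 1) (card (neighbours Mhat t))"
      unfolding c_def by (intro max_factor_le_keep_prob d m)
    then show "w (s, t) * c \<le> w (s, t) * keep_prob (card S) (d - 1) (card (neighbours Mhat t))"
      using w st ME by (intro mult_left_mono) auto
  qed
  also have "\<dots> = expected_weight S w d Mhat"
    using expected_weight_eq[OF S fin MST] by simp
  finally show ?thesis by (simp add: c_def)
qed

section \<open>Tightness\<close>

text \<open>The extremal instance is a star with unit weights, unbounded \<open>b\<close> and \<open>(k - 1) * d + 1\<close> leaves:
  the fewest for which the centre has reduced bound \<open>k\<close>.\<close>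
lemma ratio_at_most_on_star:
  assumes d: "1 \<le> d" and k: "1 \<le> k" and c: "keep_prob ((k - 1) * d + 1) (d - 1) k \<le> c"
  shows "ratio_at_most_on_some_instance d k c"
proof -
  define n where "n = (k - 1) * d + 1"
  define S where "S = {..<n}"
  define E where "E = S \<times> {n}"
  define w :: "nat \<times> nat \<Rightarrow> real" where "w = (\<lambda>_. 1)"
  define b :: "nat \<Rightarrow> enat" where "b = (\<lambda>_. \<infinity>)"
  have S: "finite S" "card S = n" by (auto simp: S_def)
  have G: "bip_instance S {n} E w d"
    using d by (auto simp: bip_instance_def S_def E_def w_def)
  have weight: "weight w M = real (card M)" for M by (simp add: weight_def w_def)
  have "\<lceil>real n / real d\<rceil> = int k"
  proof (rule ceiling_unique)
    have n: "real n = (real k - 1) * real d + 1" using k by (simp add: n_def of_nat_diff)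
    show "of_int (int k) - 1 < real n / real d" using d by (simp add: n field_simps)
    show "real n / real d \<le> of_int (int k)" using d by (simp add: n field_simps)
  qed
  then have red: "reduced_bound S {n} d b n = enat k" by (simp add: reduced_bound_def b_def S)
  then have max_red: "max_reduced_bound S {n} d b = k" by (simp add: max_reduced_bound_def)
  \<comment> \<open>Every \<open>d\<close>-th leaf: 0, d, ..., (k - 1) d. The last one is
    \<open>n - 1\<close>, so these \<open>k\<close> leaves just fit; they make the optimum at least
    \<open>k\<close>.\<close>
  define M where "M = (\<lambda>i. (d * i, n)) ` {..<k}"
  have cardM: "card M = k"
    unfolding M_def using d by (subst card_image) (auto simp: inj_on_def)
  have "d * i < n" if "i < k" for i
  proof -
    have "d * i \<le> d * (k - 1)" using that by (intro mult_left_mono) auto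
    then show ?thesis unfolding n_def mult.commute[of d "k - 1", symmetric] by linarith
  qed
  then have ME: "M \<subseteq> E" by (auto simp: M_def E_def S_def)
  have xs: "[0..<n] \<in> permutations_of_set S" by (auto simp: permutations_of_set_def S_def)
  have M: "distance_b_matching S {n} E d b [0..<n] M"
    unfolding distance_b_matching_def b_matching_def
  proof (intro conjI allI impI)
    fix i j t
    assume *: "i < length [0..<n]" "j < length [0..<n]"
      "([0..<n] ! i, t) \<in> M \<and> ([0..<n] ! j, t) \<in> M \<and> i \<noteq> j"
    then obtain i' j' where ij: "i = d * i'" "j = d * j'" "i' \<noteq> j'" by (auto simp: M_def)
    have "int d * 1 \<le> int d * \<bar>int i' - int j'\<bar>" using ij by (intro mult_left_mono) auto
    also have "\<dots> = \<bar>int d * (int i' - int j')\<bar>" by (simp add: abs_mult)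
    finally show "int d \<le> \<bar>int i - int j\<bar>" using ij by (simp add: right_diff_distrib)
  qed (use ME in \<open>auto simp: b_def\<close>)
  have opt: "real k \<le> optimum S {n} E w d b"
    using weight_le_optimum[OF G xs M] by (simp add: weight cardM)
  have "expected_weight S w d Mhat \<le> c * optimum S {n} E w d b"
    if Mhat: "max_weight_b_matching S {n} E w (reduced_bound S {n} d b) Mhat" for Mhat
  proof -
    have sub: "Mhat \<subseteq> S \<times> {n}"
      using Mhat unfolding max_weight_b_matching_def b_matching_def E_def by blast
    then have fin: "finite Mhat" by (rule finite_subset) (simp add: S)
    have "Mhat = (\<lambda>s. (s, n)) ` neighbours Mhat n" using sub by (auto simp: neighbours_def)
    then have "card Mhat = card ((\<lambda>s. (s, n)) ` neighbours Mhat n)" by simp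
    then have cN: "card Mhat = card (neighbours Mhat n)" by (simp add: card_image inj_on_def)
    have "edge_degree Mhat n = card (neighbours Mhat n)"
      using sub by (rule edge_degree_T) (auto simp: S_def)
    \<comment> \<open>Any optimal \<open>Mhat\<close> has exactly \<open>k\<close> edges: the centre
      allows no more, and \<open>M\<close> is a competitor with \<open>k\<close>.\<close>
    then have "card Mhat \<le> k"
      using Mhat red by (auto simp: max_weight_b_matching_def b_matching_def cN)
    moreover have "k \<le> card Mhat"
      using Mhat distance_b_matching_imp_b_matching[OF G xs M] cardM
      by (auto simp: max_weight_b_matching_def weight)
    ultimately have ck: "card Mhat = k" by simp
    have "expected_weight S w d Mhat = (\<Sum>(s, t)\<in>Mhat. keep_prob n (d - 1) k)"
      unfolding expected_weight_eq[OF S(1) fin sub]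
      using sub cN ck by (intro sum.cong refl) (auto simp: w_def S)
    also have "\<dots> = real k * keep_prob n (d - 1) k" by (simp add: ck)
    also have "\<dots> \<le> real k * c" using c by (intro mult_left_mono) (auto simp: n_def)
    \<comment> \<open>Replacing \<open>k\<close> by the optimum needs \<open>c >= 0\<close>, which
      the lower bound on \<open>keep_prob\<close> provides.\<close>
    also have "\<dots> \<le> optimum S {n} E w d b * c"
    proof (rule mult_right_mono[OF opt])
      have "0 \<le> factor_d d" using d by (simp add: factor_d_def)
      also have "\<dots> \<le> keep_prob n (d - 1) k"
        by (rule factor_d_le_keep_prob[OF d k]) (simp add: n_def)
      finally show "0 \<le> c" using c by (simp add: n_def)
    qed
    finally show ?thesis by (simp add: mult.commute)
  qed
  then show ?thesis
    unfolding ratio_at_most_on_some_instance_def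
    using G max_red opt k by (intro exI[of _ S] exI[of _ "{n}"] exI[of _ E] exI[of _ w] exI[of _ b]) auto
qed

text \<open>For \<open>k > 1\<close>, \<open>(d - 1) / ((k - 1) * d + 1)\<close> tends to
  \<open>1 / (k - 1)\<close>, and the rest is a polynomial in it. For \<open>k = 1\<close> the
  sequence is constant.\<close>

lemma keep_prob_star_limit:
  assumes k: "1 \<le> k"
  shows "(\<lambda>d. (1 + (real k - 1) * (1 - (real d - 1) / ((real k - 1) * real d + 1)) ^ k) / real k)
           \<longlonglongrightarrow> factor_k k"
proof (cases "k = 1")
  case True
  then show ?thesis by (simp add: factor_k_def)
next
  case False
  define a where "a = real k - 1"
  have a: "a > 0" using k False by (simp add: a_def)
  have "(\<lambda>d. (real d - 1) / (a * real d + 1)) \<longlonglongrightarrow> 1 / a"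
    using a by real_asymp (simp add: field_simps)
  moreover have "isCont (\<lambda>x. (1 + a * (1 - x) ^ k) / real k) (1 / a)"
    using k by (intro continuous_intros) simp
  ultimately show ?thesis
    unfolding factor_k_def a_def[symmetric] by (rule isCont_tendsto_compose[rotated])
qed

text \<open>Both tightness claims use the same stars: growing \<open>k\<close> for fixed
  \<open>d\<close> isolates \<open>factor_d\<close>, growing \<open>d\<close> for fixed
  \<open>k\<close> isolates \<open>factor_k\<close>.\<close>

theorem theorem13:
  shows "(\<forall>(S :: 'v set) T E w d b Mhat.
            bip_instance S T E w d \<longrightarrow>
            max_weight_b_matching S T E w (reduced_bound S T d b) Mhat \<longrightarrow>
              (\<forall>(xs, M) \<in> set_pmf (random_order_algorithm S d Mhat).
                 xs \<in> permutations_of_set S \<and> distance_b_matching S T E d b xs M) \<and>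
              expected_weight S w d Mhat \<ge>
                max (factor_d d) (factor_k (max_reduced_bound S T d b)) * optimum S T E w d b)
         \<and> (\<forall>d\<ge>1. \<forall>\<epsilon>>0. \<exists>k0. \<forall>k\<ge>k0. ratio_at_most_on_some_instance d k (factor_d d + \<epsilon>))
         \<and> (\<forall>k\<ge>1. \<forall>\<epsilon>>0. \<exists>d0. \<forall>d\<ge>d0. ratio_at_most_on_some_instance d k (factor_k k + \<epsilon>))"
proof (intro conjI allI impI)
  fix S T :: "'v set" and E w d b Mhat
  assume G: "bip_instance S T E w d"
    and M: "max_weight_b_matching S T E w (reduced_bound S T d b) Mhat"
  then have "set_pmf (random_order_algorithm S d Mhat)
      = (\<lambda>xs. (xs, selected_edges d Mhat xs)) ` permutations_of_set S"
    by (simp add: random_order_algorithm_def bip_instance_def set_pmf_of_set)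
  then show "\<forall>(xs, M) \<in> set_pmf (random_order_algorithm S d Mhat).
      xs \<in> permutations_of_set S \<and> distance_b_matching S T E d b xs M"
    using M distance_b_matching_selected_edges[OF G] by (auto simp: max_weight_b_matching_def)
  show "max (factor_d d) (factor_k (max_reduced_bound S T d b)) * optimum S T E w d b
      \<le> expected_weight S w d Mhat"
    using G M by (rule expected_weight_ge)
next
  fix d :: nat and \<epsilon> :: real
  assume d: "1 \<le> d" and \<epsilon>: "0 < \<epsilon>"
  \<comment> \<open>Chosen so that the error \<open>1 / k\<close> in
    \<open>keep_prob_le_factor_d\<close> is below \<epsilon> for all \<open>k >= k0\<close>.\<close>
  obtain k0 :: nat where k0: "1 / \<epsilon> < real k0" using reals_Archimedean2 by blast
  have "ratio_at_most_on_some_instance d k (factor_d d + \<epsilon>)" if "k0 \<le> k" for k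
  proof (rule ratio_at_most_on_star[OF d])
    have "1 / \<epsilon> < real k" using k0 that by linarith
    moreover have "0 < 1 / \<epsilon>" using \<epsilon> by simp
    ultimately have k: "0 < real k" "1 / real k < \<epsilon>" using \<epsilon> by (linarith, simp add: divide_less_eq mult.commute)
    then show k1: "1 \<le> k" by simp
    show "keep_prob ((k - 1) * d + 1) (d - 1) k \<le> factor_d d + \<epsilon>"
      using keep_prob_le_factor_d[OF d k1 refl] k by linarith
  qed
  then show "\<exists>k0. \<forall>k\<ge>k0. ratio_at_most_on_some_instance d k (factor_d d + \<epsilon>)" by blast
next
  fix k :: nat and \<epsilon> :: real
  assume k: "1 \<le> k" and \<epsilon>: "0 < \<epsilon>"
  have "\<forall>\<^sub>F d in sequentially.
      (1 + (real k - 1) * (1 - (real d - 1) / ((real k - 1) * real d + 1)) ^ k) / real k < factor_k k + \<epsilon>"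
    by (rule order_tendstoD(2)[OF keep_prob_star_limit[OF k]]) (use \<epsilon> in simp)
  then have "\<forall>\<^sub>F d in sequentially. ratio_at_most_on_some_instance d k (factor_k k + \<epsilon>)"
    using eventually_ge_at_top[of 1]
  proof eventually_elim
    case (elim d)
    then show ?case
      using keep_prob_le_power[OF elim(2) k refl] by (intro ratio_at_most_on_star k) auto
  qed
  then show "\<exists>d0. \<forall>d\<ge>d0. ratio_at_most_on_some_instance d k (factor_k k + \<epsilon>)"
    by (simp add: eventually_sequentially)
qed

end
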